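(* Let $r\ge1$ be an integer and $x\in\mathbb{C}$. For every integer $n\ge0$, \[ D_r(n;x)=\sum_{j=0}^{r-1}b_{r,j}(n;x)\,D_r(j;x), \] where, for $0\le j\le r-1$, the polynomials $b_{r,j}(n;x)$ are defined by $b_{r,j}(n;x)=\delta_{j,n}$ for $0\le n\le r-1$ and $b_{r,j}(n+r;x)=x\sum_{k=0}^{n}\binom{n}{k}b_{r,j}(k;x)$ for $n\ge0$.
   Context: For integers $r\ge1$, $n\ge0$ and $x\in\mathbb{C}$, $D_r(n;x)\coloneqq\sum_{k=0}^{\infty}\frac{k^nx^k}{(k!)^r}$, with the convention $0^0=1$. $\delta_{j,n}$ is the Kronecker delta. *)

theory Defs
  imports "HOL-Analysis.Analysis" "HOL-Computational_Algebra.Polynomial"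
begin

text \<open>
  The convention \<open>0^0 = 1\<close> is built into the power operation. For \<open>r \<ge> 1\<close> the series converges
  absolutely for every complex \<open>x\<close>, see \<open>summable_D\<close> below.
\<close>

definition D :: "nat \<Rightarrow> nat \<Rightarrow> complex \<Rightarrow> complex" where
  "D r n x = (\<Sum>k. of_nat k ^ n * x ^ k / fact k ^ r)"

text \<open>
  The guard \<open>r = 0\<close> only serves termination; the case is excluded by \<open>r \<ge> 1\<close>. The two
  defining clauses in their usual form are \<open>b_init\<close> and \<open>b_rec\<close>.
\<close>

function b :: "nat \<Rightarrow> nat \<Rightarrow> nat \<Rightarrow> complex poly" where
  "b r j n =
    (if r = 0 \<or> n < r then (if j = n then 1 else 0)
     else [:0, 1:] * (\<Sum>k=0..n-r. of_nat ((n - r) choose k) * b r j k))"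
  by auto
termination by (relation "Wellfounded.measure (\<lambda>(r, j, n). n)") auto

declare b.simps [simp del]

lemma b_init: "n < r \<Longrightarrow> b r j n = (if j = n then 1 else 0)"
  by (subst b.simps) simp

lemma b_rec:
  assumes "r \<ge> 1"
  shows "b r j (n + r) = [:0, 1:] * (\<Sum>k=0..n. of_nat (n choose k) * b r j k)"
  using assms by (subst b.simps) simp

lemma summable_D:
  fixes x :: complex
  assumes "r \<ge> 1"
  shows "summable (\<lambda>k. norm (of_nat k ^ n * x ^ k / fact k ^ r))"
proof (rule summable_comparison_test')
  define c where "c = norm x * exp (real n)"
  show "summable (\<lambda>k. c ^ k /\<^sub>R fact k)"
    by (rule summable_exp_generic)
  fix k :: nat
  have "real k \<le> exp (real k)"
    using exp_ge_add_one_self[of "real k"] by linarith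
  hence "real k ^ n \<le> exp (real k) ^ n"
    by (intro power_mono) auto
  also have "\<dots> = exp (real n) ^ k"
    by (simp add: exp_of_nat_mult[symmetric] mult.commute)
  finally have "real k ^ n * norm x ^ k \<le> exp (real n) ^ k * norm x ^ k"
    by (intro mult_right_mono) auto
  hence 1: "real k ^ n * norm x ^ k \<le> c ^ k"
    by (simp add: c_def power_mult_distrib mult.commute)
  have 2: "(fact k :: real) \<le> fact k ^ r"
    using assms self_le_power[of "fact k :: real" r] by (simp add: fact_ge_1)
  have "real k ^ n * norm x ^ k / fact k ^ r \<le> c ^ k / fact k"
    using 1 2 by (intro frac_le) (auto simp: c_def)
  thus "norm (norm (of_nat k ^ n * x ^ k / fact k ^ r)) \<le> c ^ k /\<^sub>R fact k"
    by (simp add: norm_mult norm_divide norm_power divide_real_def[symmetric] field_simps)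
qed

end

theory Submission
  imports Defs
begin

text \<open>For fixed x, the sequence \<open>D r n x\<close> obeys the same linear recurrence in n
  as each \<open>b r j n\<close> evaluated at x (\<open>D_rec\<close>). The \<open>b r j\<close> are
  the fundamental solutions, with Kronecker deltas as initial values, so D is their combination
  weighted by its own first r values. As the recurrence reaches back to all smaller indices, the
  induction is strong.\<close>

lemma D_rec:
  assumes "r \<ge> 1"
  shows "D r (n + r) x = x * (\<Sum>k=0..n. of_nat (n choose k) * D r k x)"
proof -
  define f where "f = (\<lambda>m i. of_nat i ^ m * x ^ i / (fact i ^ r :: complex))"
  have summable: "summable (f m)" for m
    unfolding f_def using summable_D[OF assms] by (rule summable_norm_cancel)
  have D_eq: "D r m x = suminf (f m)" for m
    by (simp add: D_def f_def)
  \<comment> \<open>After the index shift, r of the n + r factors i+1 cancel against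
    \<open>fact (Suc i) ^ r\<close>; the binomial theorem expands the other n.\<close>
  have "f (n + r) (Suc i) = x * (\<Sum>k=0..n. of_nat (n choose k) * f k i)" for i
  proof -
    have "f (n + r) (Suc i) = x * ((of_nat i + 1) ^ n * (x ^ i / fact i ^ r))"
      by (simp add: f_def power_add power_mult_distrib add.commute del: of_nat_Suc)
        (simp add: add.commute)
    also have "(of_nat i + 1 :: complex) ^ n = (\<Sum>k=0..n. of_nat (n choose k) * of_nat i ^ k)"
      by (simp add: binomial_ring atLeast0AtMost)
    finally show ?thesis
      by (simp only: sum_distrib_right) (simp add: f_def mult.assoc)
  qed
  \<comment> \<open>The exponent n + r is positive, so 0^0 does not occur and the shift loses no
    term.\<close>
  moreover have "f (n + r) 0 = 0"
    using assms by (simp add: f_def)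
  ultimately have "suminf (f (n + r)) = (\<Sum>i. x * (\<Sum>k=0..n. of_nat (n choose k) * f k i))"
    using suminf_split_head[OF summable, of "n + r"] by simp
  also have "\<dots> = x * (\<Sum>k=0..n. of_nat (n choose k) * suminf (f k))"
    by (simp add: suminf_mult suminf_sum summable summable_mult summable_sum)
  finally show ?thesis
    by (simp add: D_eq)
qed

theorem theorem2p9:
  fixes r n :: nat and x :: complex
  assumes "r \<ge> 1"
  shows "D r n x = (\<Sum>j=0..r-1. poly (b r j n) x * D r j x)"
proof (induction n rule: less_induct)
  case (less n)
  show ?case
  proof (cases "n < r")
    case True
    have "(\<Sum>j=0..r-1. poly (b r j n) x * D r j x) = (\<Sum>j=0..r-1. if j = n then D r j x else 0)"
      using True by (intro sum.cong) (auto simp: b_init)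
    then show ?thesis
      using True by (simp add: sum.delta)
  next
    case False
    then obtain m where n: "n = m + r"
      by (metis add.commute le_Suc_ex not_less)
    \<comment> \<open>The induction hypothesis covers every k \<le> m, since m < m + r = n by r
      \<ge> 1.\<close>
    have "D r n x = x * (\<Sum>k=0..m. of_nat (m choose k) * (\<Sum>j=0..r-1. poly (b r j k) x * D r j x))"
      unfolding n D_rec[OF assms] using less assms n by simp
    also have "\<dots> = (\<Sum>k=0..m. \<Sum>j=0..r-1. x * of_nat (m choose k) * poly (b r j k) x * D r j x)"
      by (simp add: sum_distrib_left mult.assoc)
    also have "\<dots> = (\<Sum>j=0..r-1. \<Sum>k=0..m. x * of_nat (m choose k) * poly (b r j k) x * D r j x)"
      by (rule sum.swap)
    \<comment> \<open>For each j, the sum over k is now \<open>b_rec\<close> evaluated at x, times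
      \<open>D r j x\<close>.\<close>
    also have "\<dots> = (\<Sum>j=0..r-1. poly (b r j n) x * D r j x)"
      by (simp add: n b_rec[OF assms] poly_sum sum_distrib_left sum_distrib_right mult.assoc)
    finally show ?thesis .
  qed
qed

end
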